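(* For a fixed positive integer $d$, let $$c_d=\lim_{n\to\infty}\frac{\max\{V_{n,d}(k,l)\mid k,l\}}{n},$$ where the maximum is over all positive integers $k,l$ with $l\le k\le n-1$, and $V_{n,d}(k,l)$ is the expected reward, with reward function $v_{n,d}$, of the stopping rule $\mathcal{R}_n(k,l)$. Then (the limits for $d=1,2$ exist and) $c_1=1/\mathrm{e}\approx 0.36788$, and $c_2=2x-x^2\approx 0.51239$, where $x$ is the smaller root of the equation $2x-2\log x=3$ (with $\log$ the natural logarithm).
   Context: The stopping rule $\mathcal{R}_n(k,l)$ (for positive integers $l\le k\le n-1$) selects an element $s$ of a permutation $a_1,a_2,\dots,a_n$ of $\{1,2,\dots,n\}$ as follows. Let $t$ be the $l$-th lowest value among $a_1,\dots,a_k$, and let $I=\{i\in\{1,\dots,n-k\} : a_{k+i}<t\}$. Let $j=\min I$ if $I\ne\emptyset$ and $j=n-k$ if $I=\emptyset$. The rule selects $s=a_{k+j}$. For $1\le d\le n$, the reward for selecting $s$ is $v_{n,d}(s)=n+1-s$ if $s\le d$ and $v_{n,d}(s)=0$ otherwise. $V_{n,d}(k,l)$ denotes the expected value of $v_{n,d}(s)$ when the permutation is uniformly random among all $n!$ permutations. *)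

theory Defs
  imports "HOL-Probability.Probability" "HOL-Combinatorics.Permutations"
begin

text \<open>
  The permutation \<open>a\<^sub>1, \<dots>, a\<^sub>n\<close> is a function \<open>a\<close> with \<open>a permutes {1..n}\<close>.
\<close>

(* lists are indexed from 0, so the l-th lowest value sits at index l - 1 *)
definition threshold :: "(nat \<Rightarrow> nat) \<Rightarrow> nat \<Rightarrow> nat \<Rightarrow> nat" where
  "threshold a k l = sorted_list_of_set (a ` {1..k}) ! (l - 1)"

definition selected :: "nat \<Rightarrow> nat \<Rightarrow> nat \<Rightarrow> (nat \<Rightarrow> nat) \<Rightarrow> nat" where
  "selected n k l a =
     (let t = threshold a k l;
          I = {i \<in> {1..n - k}. a (k + i) < t};
          j = (if I \<noteq> {} then Min I else n - k)
      in a (k + j))"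

definition reward :: "nat \<Rightarrow> nat \<Rightarrow> nat \<Rightarrow> real" where
  "reward n d s = (if s \<le> d then real n + 1 - real s else 0)"

definition expected_reward :: "nat \<Rightarrow> nat \<Rightarrow> nat \<Rightarrow> nat \<Rightarrow> real" where
  "expected_reward n d k l =
     measure_pmf.expectation (pmf_of_set {a. a permutes {1..n}})
       (\<lambda>a. reward n d (selected n k l a))"

text \<open>
  The set below is empty for \<open>n < 2\<close>, so \<open>max_reward n d\<close> is meaningful only for \<open>n \<ge> 2\<close>;
  and the reward is intended for \<open>1 \<le> d \<le> n\<close>. Neither affects the limit.
\<close>

definition max_reward :: "nat \<Rightarrow> nat \<Rightarrow> real" where
  "max_reward n d =
     Max {expected_reward n d k l |k l. 1 \<le> l \<and> l \<le> k \<and> k \<le> n - 1}"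

text \<open>
  \<open>lim\<close> is a definite description, hence meaningful only for a convergent sequence.
\<close>

definition limit_const :: "nat \<Rightarrow> real" where
  "limit_const d = lim (\<lambda>n. max_reward n d / real n)"

end

theory Submission imports Defs begin

text \<open>
  With \<open>l = 1\<close> the rule stops at the first value below \<open>min a\<^sub>1 \<dots> a\<^sub>k\<close>. It selects \<open>1\<close>, sitting at
  position \<open>m > k\<close>, exactly if the minimum of the first \<open>m - 1\<close> values lies among the first \<open>k\<close>;
  by symmetry this has probability \<open>k / (n (m - 1))\<close>, so the total is close to \<open>- x ln x\<close> with
  \<open>x = k / n\<close>. The same event for the value \<open>2\<close> has the same probability, and up to \<open>a\<^sub>n = 2\<close> it fails to
  select \<open>2\<close> only if \<open>1\<close> is among the first \<open>k\<close> values and \<open>2\<close> is not, which costs about \<open>x (1 - x)\<close>. For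
  \<open>d = 1\<close> no \<open>l\<close> beats \<open>l = 1\<close>, by inclusion of events. For \<open>d = 2\<close> and \<open>l \<ge> 2\<close>, selecting at position \<open>m\<close>
  forces the two smallest of the first \<open>m - 1\<close> values to lie among the first \<open>k\<close>, and this bounds the
  scaled reward by \<open>2 x (1 - x) \<le> 1/2\<close> in the limit, below \<open>c\<^sub>2\<close>. It remains to maximize \<open>- x ln x\<close> and
  \<open>- 2 x ln x - x (1 - x)\<close>.
\<close>

subsection \<open>Positions of the smallest values\<close>

text \<open>Double counting: the fibres over \<open>X\<close> partition \<open>A\<close> and all
  have the same size. One inequality in \<open>equal\<close> suffices because \<open>x\<close> and
  \<open>y\<close> may trade places. The product form stays within the natural numbers.\<close>

lemma card_equal_fibres:
  assumes "finite A" "finite X" "Y \<subseteq> X" "x\<^sub>0 \<in> X"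
    and unique: "\<And>a. a \<in> A \<Longrightarrow> \<exists>!x. x \<in> X \<and> R a x"
    and equal: "\<And>x y. x \<in> X \<Longrightarrow> y \<in> X \<Longrightarrow> card {a \<in> A. R a x} \<le> card {a \<in> A. R a y}"
  shows "card {a \<in> A. \<exists>x\<in>Y. R a x} * card X = card Y * card A"
proof -
  define c where "c = card {a \<in> A. R a x\<^sub>0}"
  have c: "card {a \<in> A. R a x} = c" if "x \<in> X" for x
    unfolding c_def using equal[OF that \<open>x\<^sub>0 \<in> X\<close>] equal[OF \<open>x\<^sub>0 \<in> X\<close> that] by simp
  have *: "card {a \<in> A. \<exists>x\<in>Z. R a x} = card Z * c" if "Z \<subseteq> X" for Z
  proof -
    have "{a \<in> A. \<exists>x\<in>Z. R a x} = (\<Union>x\<in>Z. {a \<in> A. R a x})" by auto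
    moreover have "card (\<Union>x\<in>Z. {a \<in> A. R a x}) = (\<Sum>x\<in>Z. card {a \<in> A. R a x})"
    proof (rule card_UN_disjoint)
      show "finite Z" using that assms(2) by (rule finite_subset)
      show "\<forall>x\<in>Z. \<forall>y\<in>Z. x \<noteq> y \<longrightarrow> {a \<in> A. R a x} \<inter> {a \<in> A. R a y} = {}"
        using that unique by blast
    qed (use assms(1) in simp)
    moreover have "(\<Sum>x\<in>Z. card {a \<in> A. R a x}) = card Z * c"
      using that c by (simp add: subset_iff)
    ultimately show ?thesis by simp
  qed
  have "{a \<in> A. \<exists>x\<in>X. R a x} = A" using unique by blast
  then have "card A = card X * c" using *[of X] by simp
  then show ?thesis using *[OF assms(3)] by simp
qed

text \<open>Closure under permuting the first \<open>N\<close> positions makes all orderings of the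
  first \<open>N\<close> values equally frequent in \<open>A\<close>; injectivity excludes ties. The
  set of all permutations of \<open>{1..n}\<close> qualifies for \<open>N = n\<close>, and so does
  its part with a prescribed value at a position after \<open>N\<close>.\<close>

definition relabel_closed :: "(nat \<Rightarrow> nat) set \<Rightarrow> nat \<Rightarrow> bool" where
  "relabel_closed A N \<longleftrightarrow> (\<forall>a\<in>A. inj a) \<and> (\<forall>a\<in>A. \<forall>\<sigma>. \<sigma> permutes {1..N} \<longrightarrow> a \<circ> \<sigma> \<in> A)"

text \<open>Composition with a permutation is injective, so it embeds one counted set into the
  other. This supplies the \<open>equal\<close> hypothesis of
  \<open>card_equal_fibres\<close>.\<close>

lemma card_relabel_le:
  assumes "finite A" "\<And>a. a \<in> A \<Longrightarrow> P a \<Longrightarrow> a \<circ> \<sigma> \<in> A \<and> Q (a \<circ> \<sigma>)"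
    and "\<sigma> permutes (S :: nat set)"
  shows "card {a \<in> A. P a} \<le> card {a \<in> A. Q a}"
proof (rule card_inj_on_le)
  show "inj_on (\<lambda>a. a \<circ> \<sigma>) {a \<in> A. P a}"
  proof (rule inj_onI)
    fix a b assume "a \<circ> \<sigma> = b \<circ> \<sigma>"
    then show "a = b"
      by (metis assms(3) comp_id fun.map_comp permutes_inv_o(1))
  qed
qed (use assms in auto)

text \<open>Swapping two positions carries a minimum at one to a minimum at the other, so the
  minimum sits equally often at each of the \<open>N\<close> positions.\<close>

lemma card_min_position:
  assumes "finite A" "relabel_closed A N" "k \<le> N" "N \<ge> 1"
  shows "card {a \<in> A. \<exists>p\<in>{1..k}. \<forall>i\<in>{1..N}. a p \<le> a i} * N = k * card A"
proof -
  let ?R = "\<lambda>(a::nat\<Rightarrow>nat) p. \<forall>i\<in>{1..N}. a p \<le> a i"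
  have "card {a \<in> A. \<exists>p\<in>{1..k}. ?R a p} * card {1..N} = card {1..k} * card A"
  proof (rule card_equal_fibres[where x\<^sub>0 = 1])
    fix a assume a: "a \<in> A"
    then have inj: "inj a" using assms(2) by (simp add: relabel_closed_def)
    have "\<exists>p\<in>{1..N}. \<forall>i\<in>{1..N}. a p \<le> a i"
      using ex_min_if_finite[of "a ` {1..N}"] assms(4) by (fastforce simp: not_less)
    then show "\<exists>!p. p \<in> {1..N} \<and> ?R a p"
      using inj by (metis dual_order.antisym injD)
  next
    fix p q assume pq: "p \<in> {1..N}" "q \<in> {1..N}"
    let ?s = "Transposition.transpose p q"
    have s: "?s permutes {1..N}" using pq by (simp add: permutes_swap_id)
    show "card {a \<in> A. ?R a p} \<le> card {a \<in> A. ?R a q}"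
    proof (rule card_relabel_le[OF assms(1) _ s])
      fix a assume "a \<in> A" "?R a p"
      moreover have "?s i \<in> {1..N}" if "i \<in> {1..N}" for i
        using permutes_in_image[OF s, of i] that by simp
      ultimately show "a \<circ> ?s \<in> A \<and> ?R (a \<circ> ?s) q"
        using assms(2) s by (auto simp: relabel_closed_def)
    qed
  qed (use assms in auto)
  then show ?thesis by simp
qed

text \<open>A first transposition sends \<open>p\<close> to \<open>p'\<close> and \<open>q\<close>
  to some \<open>r\<close> other than \<open>p'\<close>; a second one sends \<open>r\<close> to
  \<open>q'\<close> and leaves \<open>p'\<close> alone.\<close>

lemma ex_permutes_pair:
  assumes "p \<in> S" "q \<in> S" "p \<noteq> q" "p' \<in> S" "q' \<in> S" "p' \<noteq> q'"
  shows "\<exists>\<sigma>. \<sigma> permutes S \<and> \<sigma> p = p' \<and> \<sigma> q = q'"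
proof -
  define r where "r = Transposition.transpose p p' q"
  have r: "r \<in> S" "r \<noteq> p'"
    using assms by (auto simp: r_def Transposition.transpose_def)
  have "Transposition.transpose r q' \<circ> Transposition.transpose p p' permutes S"
    using assms r by (intro permutes_compose permutes_swap_id)
  moreover have "(Transposition.transpose r q' \<circ> Transposition.transpose p p') p = p'"
    using r assms by simp
  moreover have "(Transposition.transpose r q' \<circ> Transposition.transpose p p') q = q'"
    by (simp flip: r_def)
  ultimately show ?thesis by blast
qed

text \<open>The pair consists of the positions of the smallest and of the second smallest of the first \<open>N\<close> values.\<close>

definition two_min_at :: "(nat \<Rightarrow> nat) \<Rightarrow> nat \<Rightarrow> nat \<times> nat \<Rightarrow> bool" where
  "two_min_at a N = (\<lambda>(p, q). a p < a q \<and> (\<forall>i\<in>{1..N} - {p, q}. a q < a i))"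

text \<open>\<open>N \<ge> 2\<close> leaves a position once that of the minimum is removed, and
  injectivity makes the minimality of both choices strict.\<close>

lemma two_min_at_unique:
  assumes "inj a" "N \<ge> 2"
  shows "\<exists>!x. x \<in> {1..N} \<times> {1..N} - Id \<and> two_min_at a N x"
proof -
  obtain p where p: "p \<in> {1..N}" "\<forall>i\<in>{1..N}. a p \<le> a i"
    using ex_min_if_finite[of "a ` {1..N}"] assms(2) by (fastforce simp: not_less)
  have "{1..N} - {p} \<noteq> {}"
  proof
    assume "{1..N} - {p} = {}"
    then have "card {1..N} \<le> card {p}" by (intro card_mono) auto
    then show False using assms(2) by simp
  qed
  then obtain q where q: "q \<in> {1..N} - {p}" "\<forall>i\<in>{1..N}-{p}. a q \<le> a i"
    using ex_min_if_finite[of "a ` ({1..N}-{p})"] by (fastforce simp: not_less)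
  have inj: "a i = a j \<longleftrightarrow> i = j" for i j using assms(1) by (auto dest: injD)
  show ?thesis
  proof (rule ex1I[of _ "(p, q)"])
    show "(p, q) \<in> {1..N} \<times> {1..N} - Id \<and> two_min_at a N (p, q)"
      using p q inj by (auto simp: two_min_at_def le_less)
  next
    fix x assume x: "x \<in> {1..N} \<times> {1..N} - Id \<and> two_min_at a N x"
    obtain p' q' where [simp]: "x = (p', q')" by force
    have x': "p' \<in> {1..N}" "q' \<in> {1..N}" "p' \<noteq> q'" "a p' < a q'"
      "\<And>i. i \<in> {1..N} - {p', q'} \<Longrightarrow> a q' < a i"
      using x by (auto simp: two_min_at_def)
    have "p' = p"
      using x'(1,4) x'(5)[of p] p inj by (metis DiffI insertE leD order.strict_trans singletonD)
    moreover have "q' = q"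
    proof (rule ccontr)
      assume "q' \<noteq> q"
      then have "a q' < a q" using x'(5)[of q] q(1) \<open>p' = p\<close> by auto
      moreover have "a q \<le> a q'" using q(2) x'(2,3) \<open>p' = p\<close> by auto
      ultimately show False by simp
    qed
    ultimately show "x = (p, q)" by simp
  qed
qed

lemma card_offdiagonal: "card ({1..k} \<times> {1..k} - Id) = k * (k - 1)" for k :: nat
proof -
  have "{1..k} \<times> {1..k} - Id = {1..k} \<times> {1..k} - (\<lambda>i. (i, i)) ` {1..k}" by auto
  also have "card \<dots> = k * k - k"
    by (subst card_Diff_subset) (auto simp: card_image inj_on_def)
  finally show ?thesis by (simp add: algebra_simps)
qed

text \<open>Some permutation of the positions moves any ordered pair of distinct positions to any
  other, so all \<open>N * (N - 1)\<close> pairs occur equally often.\<close>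

lemma card_two_min_positions:
  assumes "finite A" "relabel_closed A N" "N \<ge> 2" "Y \<subseteq> {1..N} \<times> {1..N} - Id"
  shows "card {a \<in> A. \<exists>x\<in>Y. two_min_at a N x} * (N * (N - 1)) = card Y * card A"
proof -
  let ?X = "{1..N} \<times> {1..N} - Id"
  have "card {a \<in> A. \<exists>x\<in>Y. two_min_at a N x} * card ?X = card Y * card A"
  proof (rule card_equal_fibres[where x\<^sub>0 = "(1, 2)"])
    fix a assume a: "a \<in> A"
    then show "\<exists>!x. x \<in> ?X \<and> two_min_at a N x"
      using assms(2,3) by (intro two_min_at_unique) (simp_all add: relabel_closed_def)
  next
    fix x y assume xy: "x \<in> ?X" "y \<in> ?X"
    obtain p q p' q' where [simp]: "x = (p, q)" "y = (p', q')" by force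
    obtain \<sigma> where \<sigma>: "\<sigma> permutes {1..N}" "\<sigma> p' = p" "\<sigma> q' = q"
      using ex_permutes_pair[of p' "{1..N}" q' p q] xy by auto
    show "card {a \<in> A. two_min_at a N x} \<le> card {a \<in> A. two_min_at a N y}"
    proof (rule card_relabel_le[OF assms(1) _ \<sigma>(1)])
      fix a assume a: "a \<in> A" "two_min_at a N x"
      have "a q < a (\<sigma> i)" if "i \<in> {1..N} - {p', q'}" for i
      proof -
        have "\<sigma> i \<in> {1..N}" using permutes_in_image[OF \<sigma>(1), of i] that by simp
        moreover have "\<sigma> i \<noteq> p" "\<sigma> i \<noteq> q"
          using permutes_inj[OF \<sigma>(1)] \<sigma> that by (auto dest: injD)
        ultimately show ?thesis using a(2) by (simp add: two_min_at_def)
      qed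
      then show "a \<circ> \<sigma> \<in> A \<and> two_min_at (a \<circ> \<sigma>) N y"
        using a assms(2) \<sigma> by (auto simp: relabel_closed_def two_min_at_def)
    qed
  qed (use assms in auto)
  then show ?thesis by (simp only: card_offdiagonal)
qed

text \<open>Equal fibres again: a permutation takes the value \<open>v\<close> at exactly one
  position, and transpositions make all positions equally frequent.\<close>

lemma card_permutes_eq_at:
  assumes "m \<in> {1..n}" "v \<in> {1..n}"
  shows "card {a. a permutes {1..n} \<and> a m = v} * n = fact n"
proof -
  let ?A = "{a. a permutes {1..n}}"
  have "card {a \<in> ?A. \<exists>x\<in>{m}. a x = v} * card {1..n} = card {m} * card ?A"
  proof (rule card_equal_fibres[where x\<^sub>0 = m])
    fix a assume "a \<in> ?A"
    then show "\<exists>!x. x \<in> {1..n} \<and> a x = v"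
      using assms(2) by (metis mem_Collect_eq permutes_def permutes_in_image)
  next
    fix x y assume xy: "x \<in> {1..n}" "y \<in> {1..n}"
    then have s: "Transposition.transpose x y permutes {1..n}" by (simp add: permutes_swap_id)
    show "card {a \<in> ?A. a x = v} \<le> card {a \<in> ?A. a y = v}"
    proof (rule card_relabel_le[OF _ _ s])
      show "a \<circ> Transposition.transpose x y \<in> ?A \<and> (a \<circ> Transposition.transpose x y) y = v"
        if "a \<in> ?A" "a x = v" for a
        using that permutes_compose[OF s, of a] by simp
    qed (simp add: finite_permutations)
  qed (use assms finite_permutations in auto)
  then show ?thesis using card_permutations[of "{1..n}" n] by simp
qed

section \<open>Probabilities under a uniformly random permutation\<close>

definition perm_prob :: "nat \<Rightarrow> ((nat \<Rightarrow> nat) \<Rightarrow> bool) \<Rightarrow> real" where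
  "perm_prob n P = real (card {a. a permutes {1..n} \<and> P a}) / fact n"

lemma perm_prob_mono:
  assumes "\<And>a. a permutes {1..n} \<Longrightarrow> P a \<Longrightarrow> Q a"
  shows "perm_prob n P \<le> perm_prob n Q"
  unfolding perm_prob_def using assms
  by (intro divide_right_mono of_nat_mono card_mono finite_subset[OF _ finite_permutations[of "{1..n}"]]) auto

lemma perm_prob_cong:
  assumes "\<And>a. a permutes {1..n} \<Longrightarrow> P a = Q a"
  shows "perm_prob n P = perm_prob n Q"
  using assms by (intro antisym perm_prob_mono) auto

lemma perm_prob_Un_le: "perm_prob n (\<lambda>a. P a \<or> Q a) \<le> perm_prob n P + perm_prob n Q"
proof -
  have "{a. a permutes {1..n} \<and> (P a \<or> Q a)} =
        {a. a permutes {1..n} \<and> P a} \<union> {a. a permutes {1..n} \<and> Q a}" by auto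
  then have "real (card {a. a permutes {1..n} \<and> (P a \<or> Q a)}) \<le>
      real (card {a. a permutes {1..n} \<and> P a}) + real (card {a. a permutes {1..n} \<and> Q a})"
    using card_Un_le[of "{a. a permutes {1..n} \<and> P a}" "{a. a permutes {1..n} \<and> Q a}"]
    by (simp flip: of_nat_add)
  then show ?thesis by (simp add: perm_prob_def divide_right_mono flip: add_divide_distrib)
qed

lemma perm_prob_diff:
  assumes "\<And>a. a permutes {1..n} \<Longrightarrow> Q a \<Longrightarrow> P a"
  shows "perm_prob n (\<lambda>a. P a \<and> \<not> Q a) = perm_prob n P - perm_prob n Q"
proof -
  let ?A = "\<lambda>P. {a. a permutes {1..n} \<and> P a}"
  have fin: "finite (?A P)" for P
    by (rule finite_subset[OF _ finite_permutations[of "{1..n}"]]) auto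
  have eq: "?A (\<lambda>a. P a \<and> \<not> Q a) = ?A P - ?A Q" by auto
  have sub: "?A Q \<subseteq> ?A P" using assms by auto
  have "real (card (?A P - ?A Q)) = real (card (?A P)) - real (card (?A Q))"
    using fin sub by (simp add: card_Diff_subset card_mono)
  then show ?thesis unfolding perm_prob_def eq by (simp add: diff_divide_distrib)
qed

lemma perm_prob_UN:
  assumes "finite J"
    and "\<And>a i j. a permutes {1..n} \<Longrightarrow> i \<in> J \<Longrightarrow> j \<in> J \<Longrightarrow> P i a \<Longrightarrow> P j a \<Longrightarrow> i = j"
  shows "perm_prob n (\<lambda>a. \<exists>j\<in>J. P j a) = (\<Sum>j\<in>J. perm_prob n (P j))"
proof -
  have "{a. a permutes {1..n} \<and> (\<exists>j\<in>J. P j a)} = (\<Union>j\<in>J. {a. a permutes {1..n} \<and> P j a})"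
    by auto
  moreover have "card (\<Union>j\<in>J. {a. a permutes {1..n} \<and> P j a}) =
      (\<Sum>j\<in>J. card {a. a permutes {1..n} \<and> P j a})"
    using assms by (intro card_UN_disjoint) (auto intro: finite_subset[OF _ finite_permutations[of "{1..n}"]])
  ultimately show ?thesis by (simp add: perm_prob_def sum_divide_distrib)
qed

lemma perm_prob_eq_at:
  assumes "m \<in> {1..n}" "v \<in> {1..n}"
  shows "perm_prob n (\<lambda>a. a m = v) = 1 / n"
proof -
  have "real (card {a. a permutes {1..n} \<and> a m = v}) * real n = fact n"
    using card_permutes_eq_at[OF assms] by (metis of_nat_fact of_nat_mult)
  then show ?thesis using assms by (simp add: perm_prob_def field_simps)
qed

text \<open>Permuting the positions up to \<open>j\<close> does not move \<open>m\<close>, so the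
  prescribed value survives. This lets the counting lemmas be applied conditionally on a later
  value.\<close>

lemma relabel_closed_perms:
  assumes "j < m" "j \<le> n"
  shows "relabel_closed {a. a permutes {1..n} \<and> a m = v} j"
  unfolding relabel_closed_def
proof (intro conjI ballI allI impI)
  fix a \<sigma> assume a: "a \<in> {a. a permutes {1..n} \<and> a m = v}" and \<sigma>: "\<sigma> permutes {1..j}"
  have "\<sigma> permutes {1..n}" by (rule permutes_subset[OF \<sigma>]) (use assms in auto)
  then have "a \<circ> \<sigma> permutes {1..n}" using a by (simp add: permutes_compose)
  moreover have "\<sigma> m = m" using \<sigma> assms(1) by (auto simp: permutes_def)
  ultimately show "a \<circ> \<sigma> \<in> {a. a permutes {1..n} \<and> a m = v}" using a by simp
qed (auto dest: permutes_inj)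

text \<open>In the next two predicates \<open>Suc j\<close> is the position of the value \<open>v\<close>.\<close>

definition min_before :: "nat \<Rightarrow> nat \<Rightarrow> nat \<Rightarrow> (nat \<Rightarrow> nat) \<Rightarrow> bool" where
  "min_before n k v a \<longleftrightarrow>
     (\<exists>j\<in>{k..<n}. a (Suc j) = v \<and> (\<exists>p\<in>{1..k}. \<forall>i\<in>{1..j}. a p \<le> a i))"

definition two_min_before :: "nat \<Rightarrow> nat \<Rightarrow> nat \<Rightarrow> (nat \<Rightarrow> nat) \<Rightarrow> bool" where
  "two_min_before n k v a \<longleftrightarrow>
     (\<exists>j\<in>{k..<n}. a (Suc j) = v \<and> (\<exists>x\<in>{1..k} \<times> {1..k} - Id. two_min_at a j x))"

text \<open>The value \<open>v\<close> sits at position \<open>Suc j\<close> with probability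
  \<open>1 / n\<close>; given this, the minimum of the first \<open>j\<close> values lies among the
  first \<open>k\<close> with probability \<open>k / j\<close>. The cases are disjoint because
  \<open>v\<close> has only one position.\<close>

lemma perm_prob_min_before:
  assumes "1 \<le> k" "v \<in> {1..n}"
  shows "perm_prob n (min_before n k v) = k / n * (\<Sum>j=k..<n. 1 / real j)"
proof -
  let ?P = "\<lambda>j a. a (Suc j) = v \<and> (\<exists>p\<in>{1..k}. \<forall>i\<in>{1..j}. a p \<le> a i)"
  have "perm_prob n (min_before n k v) = perm_prob n (\<lambda>a. \<exists>j\<in>{k..<n}. ?P j a)"
    by (simp add: min_before_def[abs_def])
  also have "\<dots> = (\<Sum>j=k..<n. perm_prob n (?P j))"
    by (rule perm_prob_UN) (auto dest!: permutes_inj dest: injD)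
  also have "\<dots> = (\<Sum>j=k..<n. k / n * (1 / real j))"
  proof (rule sum.cong[OF refl])
    fix j assume j: "j \<in> {k..<n}"
    let ?A = "{a. a permutes {1..n} \<and> a (Suc j) = v}"
    have fin: "finite ?A" by (rule finite_subset[OF _ finite_permutations[of "{1..n}"]]) auto
    have *: "card {a \<in> ?A. \<exists>p\<in>{1..k}. \<forall>i\<in>{1..j}. a p \<le> a i} * j = k * card ?A"
      using j assms by (intro card_min_position[OF fin] relabel_closed_perms) auto
    have "{a \<in> ?A. \<exists>p\<in>{1..k}. \<forall>i\<in>{1..j}. a p \<le> a i} = {a. a permutes {1..n} \<and> ?P j a}"
      by auto
    then have "real (card {a. a permutes {1..n} \<and> ?P j a}) * j = k * real (card ?A)"
      using arg_cong[OF *, of real] by simp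
    then have "perm_prob n (?P j) = k / j * perm_prob n (\<lambda>a. a (Suc j) = v)"
      using j assms by (simp add: perm_prob_def field_simps)
    also have "\<dots> = k / j * (1 / n)"
      using j assms by (subst perm_prob_eq_at) auto
    finally show "perm_prob n (?P j) = k / n * (1 / real j)" by simp
  qed
  finally show ?thesis by (simp add: sum_distrib_left)
qed

text \<open>As for \<open>min_before\<close>, but the conditional probability is now
  \<open>k * (k - 1) / (j * (j - 1))\<close>. Its partial fractions telescope, so the sum has a
  closed form.\<close>

lemma perm_prob_two_min_before:
  assumes "2 \<le> k" "k < n" "v \<in> {1..n}"
  shows "perm_prob n (two_min_before n k v) = k * (real n - k) / (n * (real n - 1))"
proof -
  let ?P = "\<lambda>j a. a (Suc j) = v \<and> (\<exists>x\<in>{1..k} \<times> {1..k} - Id. two_min_at a j x)"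
  have "perm_prob n (two_min_before n k v) = perm_prob n (\<lambda>a. \<exists>j\<in>{k..<n}. ?P j a)"
    by (simp add: two_min_before_def[abs_def])
  also have "\<dots> = (\<Sum>j=k..<n. perm_prob n (?P j))"
    by (rule perm_prob_UN) (auto dest!: permutes_inj dest: injD)
  also have "\<dots> = (\<Sum>j=k..<n. k * (real k - 1) / n * (1 / (real j - 1) - 1 / real j))"
  proof (rule sum.cong[OF refl])
    fix j assume j: "j \<in> {k..<n}"
    let ?A = "{a. a permutes {1..n} \<and> a (Suc j) = v}"
    let ?Y = "{1..k} \<times> {1..k} - Id"
    have fin: "finite ?A" by (rule finite_subset[OF _ finite_permutations[of "{1..n}"]]) auto
    have "card {a \<in> ?A. \<exists>x\<in>?Y. two_min_at a j x} * (j * (j - 1)) = card ?Y * card ?A"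
      using j assms by (intro card_two_min_positions[OF fin] relabel_closed_perms) auto
    moreover have "{a \<in> ?A. \<exists>x\<in>?Y. two_min_at a j x} = {a. a permutes {1..n} \<and> ?P j a}"
      by auto
    ultimately have "real (card {a. a permutes {1..n} \<and> ?P j a}) * (j * (real j - 1))
        = k * (real k - 1) * real (card ?A)"
      using j assms unfolding card_offdiagonal
      by (metis (no_types, lifting) atLeastLessThan_iff le_trans of_nat_1 of_nat_diff of_nat_mult one_le_numeral)
    then have "perm_prob n (?P j) = k * (real k - 1) / (j * (real j - 1)) * perm_prob n (\<lambda>a. a (Suc j) = v)"
      using j assms by (simp add: perm_prob_def divide_simps)
    also have "\<dots> = k * (real k - 1) / (j * (real j - 1)) * (1 / n)"
      using j assms by (subst perm_prob_eq_at) auto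
    also have "\<dots> = k * (real k - 1) / n * (1 / (real j - 1) - 1 / real j)"
      using j assms by (simp add: divide_simps)
    finally show "perm_prob n (?P j) = k * (real k - 1) / n * (1 / (real j - 1) - 1 / real j)" .
  qed
  also have "\<dots> = k * (real k - 1) / n * (\<Sum>j=k..<n. 1 / (real j - 1) - 1 / real j)"
    by (simp add: sum_distrib_left)
  also have "(\<Sum>j=k..<n. 1 / (real j - 1) - 1 / real j) = 1 / (real k - 1) - 1 / (real n - 1)"
    using assms sum_Suc_diff'[of k n "\<lambda>j. - 1 / (real j - 1)"] by simp
  also have "k * (real k - 1) / n * (1 / (real k - 1) - 1 / (real n - 1)) = k * (real n - k) / (n * (real n - 1))"
    using assms by (simp add: divide_simps)
  finally show ?thesis .
qed

text \<open>Among all \<open>n\<close> positions the two smallest values are 1 and 2, and the pair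
  of their positions is the only one by \<open>two_min_at_unique\<close>.\<close>

lemma two_min_at_perm_iff:
  assumes "a permutes {1..n}" "n \<ge> 2" "p \<in> {1..n}" "q \<in> {1..n}" "p \<noteq> q"
  shows "two_min_at a n (p, q) \<longleftrightarrow> a p = 1 \<and> a q = 2"
proof -
  have val: "two_min_at a n (p, q)" if "a p = 1" "a q = 2" for p q
  proof -
    have "a q < a i" if "i \<in> {1..n} - {p, q}" for i
    proof -
      have "a i \<in> {1..n}" using that assms(1) permutes_in_image by fastforce
      moreover have "a i \<noteq> a p" "a i \<noteq> a q"
        using that permutes_inj[OF assms(1)] by (auto dest: injD)
      ultimately show ?thesis using \<open>a p = 1\<close> \<open>a q = 2\<close> by auto
    qed
    then show ?thesis using that by (simp add: two_min_at_def)
  qed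
  have "1 \<in> a ` {1..n}" "2 \<in> a ` {1..n}"
    using assms(2) unfolding permutes_image[OF assms(1)] by auto
  then obtain p' q' where pq': "p' \<in> {1..n}" "q' \<in> {1..n}" "a p' = 1" "a q' = 2"
    by (auto elim!: imageE)
  let ?Q = "\<lambda>x. x \<in> {1..n} \<times> {1..n} - Id \<and> two_min_at a n x"
  have "\<exists>!x. ?Q x"
    using permutes_inj[OF assms(1)] assms(2) by (rule two_min_at_unique)
  moreover have "?Q (p', q')" using pq' val[OF pq'(3,4)] by auto
  moreover have "?Q (p, q)" if "two_min_at a n (p, q)" using that assms(3-5) by auto
  ultimately have "two_min_at a n (p, q) \<Longrightarrow> (p, q) = (p', q')" by blast
  then show ?thesis using pq' val by auto
qed

text \<open>The case in which \<open>min_before\<close> holds for the value 2 but the rule with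
  \<open>l = 1\<close> can miss it: the threshold is 1, nothing lies below it, and the rule runs on
  to position \<open>n\<close>.\<close>

definition split_by :: "nat \<Rightarrow> nat \<Rightarrow> (nat \<Rightarrow> nat) \<Rightarrow> bool" where
  "split_by n k a \<longleftrightarrow> (\<exists>p\<in>{1..k}. a p = 1) \<and> (\<exists>q\<in>{Suc k..n}. a q = 2)"

text \<open>The positions of 1 and 2 form a uniformly distributed ordered pair, and
  \<open>k * (n - k)\<close> of the \<open>n * (n - 1)\<close> pairs are favourable.\<close>

lemma perm_prob_split_by:
  assumes "n \<ge> 2" "k \<le> n"
  shows "perm_prob n (split_by n k) = k * (real n - k) / (n * (real n - 1))"
proof -
  let ?A = "{a. a permutes {1..n}}" and ?Y = "{1..k} \<times> {Suc k..n}"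
  have rc: "relabel_closed ?A n"
    by (auto simp: relabel_closed_def dest: permutes_inj intro: permutes_compose)
  have "card {a \<in> ?A. \<exists>x\<in>?Y. two_min_at a n x} * (n * (n - 1)) = card ?Y * card ?A"
    using assms by (intro card_two_min_positions rc finite_permutations) auto
  moreover have "{a \<in> ?A. \<exists>x\<in>?Y. two_min_at a n x} = {a. a permutes {1..n} \<and> split_by n k a}"
  proof (intro Collect_cong)
    fix a
    have "(\<exists>x\<in>?Y. two_min_at a n x) \<longleftrightarrow> split_by n k a" if "a permutes {1..n}"
    proof -
      have "two_min_at a n (p, q) \<longleftrightarrow> a p = 1 \<and> a q = 2" if "p \<in> {1..k}" "q \<in> {Suc k..n}" for p q
        using that assms \<open>a permutes {1..n}\<close> by (intro two_min_at_perm_iff) auto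
      then show ?thesis unfolding split_by_def by blast
    qed
    then show "(a \<in> ?A \<and> (\<exists>x\<in>?Y. two_min_at a n x)) = (a permutes {1..n} \<and> split_by n k a)" by auto
  qed
  ultimately have "card {a. a permutes {1..n} \<and> split_by n k a} * (n * (n - 1)) = k * (n - k) * fact n"
    using card_permutations[of "{1..n}" n] by simp
  then have "real (card {a. a permutes {1..n} \<and> split_by n k a}) * (n * (real n - 1)) = k * (real n - k) * fact n"
    using assms by (metis (no_types, lifting) le_trans of_nat_1 of_nat_diff of_nat_fact of_nat_mult one_le_numeral)
  then show ?thesis using assms by (simp add: perm_prob_def divide_simps)
qed

subsection \<open>The selected element\<close>

text \<open>These facts are all that later arguments use about the sorted list. Injectivity gives
  the list length \<open>k\<close>, so the index \<open>l - 1\<close> is valid.\<close>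

lemma threshold_props:
  assumes "a permutes {1..n}" "1 \<le> l" "l \<le> k"
  shows threshold_in: "threshold a k l \<in> a ` {1..k}"
    and threshold_one_le: "\<And>i. l = 1 \<Longrightarrow> i \<in> {1..k} \<Longrightarrow> threshold a k l \<le> a i"
    and below_threshold: "2 \<le> l \<Longrightarrow> \<exists>i\<in>{1..k}. a i < threshold a k l"
proof -
  let ?xs = "sorted_list_of_set (a ` {1..k})"
  have len: "length ?xs = k"
    using permutes_inj_on[OF assms(1)] by (simp add: card_image)
  have set: "set ?xs = a ` {1..k}" by simp
  have t: "threshold a k l = ?xs ! (l - 1)" by (simp add: threshold_def)
  show "threshold a k l \<in> a ` {1..k}"
    using nth_mem[of "l - 1" ?xs] len set t assms by simp
  show "threshold a k l \<le> a i" if "l = 1" "i \<in> {1..k}" for i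
  proof -
    have "a i \<in> set ?xs" using that by simp
    then obtain j where "j < length ?xs" "?xs ! j = a i" by (metis in_set_conv_nth)
    then show ?thesis using sorted_nth_mono[of ?xs 0 j] that t by simp
  qed
  show "\<exists>i\<in>{1..k}. a i < threshold a k l" if "2 \<le> l"
  proof -
    have "?xs ! 0 < ?xs ! (l - 1)"
      using that len assms by (intro sorted_wrt_nth_less[OF strict_sorted_list_of_set]) auto
    moreover have "?xs ! 0 \<in> a ` {1..k}"
      using nth_mem[of 0 ?xs] len set assms by simp
    ultimately show ?thesis using t by auto
  qed
qed

text \<open>The stopping position is \<open>Suc j\<close>. Either the value there beats the
  threshold, or the rule is forced to stop at \<open>n\<close>; equality cannot occur since the
  threshold is already taken at a position up to \<open>k\<close>.\<close>

lemma selected_cases: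
  assumes "a permutes {1..n}" "1 \<le> l" "l \<le> k" "k < n"
  obtains j where "j \<in> {k..<n}" "selected n k l a = a (Suc j)"
    "\<forall>i\<in>{Suc k..j}. threshold a k l < a i"
    "a (Suc j) < threshold a k l \<or> Suc j = n \<and> threshold a k l < a n"
proof -
  define t where "t = threshold a k l"
  define I where "I = {i \<in> {1..n - k}. a (k + i) < t}"
  have sel: "selected n k l a = a (k + (if I \<noteq> {} then Min I else n - k))"
    unfolding selected_def Let_def t_def[symmetric] I_def[symmetric] by (rule refl)
  have fin: "finite I" by (simp add: I_def)
  obtain p where p: "p \<in> {1..k}" "t = a p"
    using threshold_in[OF assms(1-3)] by (auto simp: t_def)
  have neq: "a i \<noteq> t" if "i > k" for i
    using that p inj_eq[OF permutes_inj[OF assms(1)], of i p] by simp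
  have notin: "t < a i" if "i > k" "i \<le> n" "i - k \<notin> I" for i
    using that neq[of i] by (auto simp: I_def)
  show thesis
  proof (cases "I = {}")
    case True
    have all: "t < a i" if "i \<in> {Suc k..n}" for i using notin[of i] that True by simp
    \<comment> \<open>The default \<open>n - k\<close> is an offset from \<open>k\<close>, so it
      means position \<open>n\<close>, that is \<open>j = n - 1\<close>.\<close>
    have "selected n k l a = a n" using sel True assms(4) by simp
    moreover have "\<forall>i\<in>{Suc k..n - 1}. t < a i" using all by auto
    ultimately show ?thesis
      using all[of n] assms(4) by (intro that[of "n - 1"]) (simp_all flip: t_def)
  next
    case False
    define m where "m = Min I"
    have "m \<in> I" unfolding m_def using fin False by (rule Min_in)
    then have m: "m \<in> {1..n - k}" "a (k + m) < t" by (auto simp: I_def)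
    have "t < a i" if i: "i \<in> {Suc k..k + m - 1}" for i
    proof -
      have "i - k \<notin> I" using Min_le[OF fin, of "i - k"] i m(1) by (auto simp flip: m_def)
      then show ?thesis using i m(1) assms(4) by (intro notin) (simp_all, linarith)
    qed
    then have "\<forall>i\<in>{Suc k..k + m - 1}. t < a i" by blast
    moreover have "selected n k l a = a (k + m)" using sel False by (simp flip: m_def)
    ultimately show ?thesis
      using m assms(4) by (intro that[of "k + m - 1"]) (auto simp flip: t_def)
  qed
qed

lemma selected_in:
  assumes "a permutes {1..n}" "1 \<le> l" "l \<le> k" "k < n"
  shows "selected n k l a \<in> {1..n}"
proof -
  obtain j where "j \<in> {k..<n}" "selected n k l a = a (Suc j)" by (rule selected_cases[OF assms])
  then show ?thesis using permutes_in_image[OF assms(1), of "Suc j"] by auto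
qed

text \<open>The minimum of the first \<open>k\<close> values is at most \<open>t\<close>, hence
  below everything passed over up to position \<open>j\<close>. Here \<open>t\<close> may be the
  threshold for any \<open>l\<close>.\<close>

lemma min_beforeI:
  assumes a: "a permutes {1..n}" "1 \<le> k" and j: "j \<in> {k..<n}" "a (Suc j) = v"
    and t: "t \<in> a ` {1..k}" "\<forall>i\<in>{Suc k..j}. t < a i"
  shows "min_before n k v a"
proof -
  obtain p where p: "p \<in> {1..k}" "\<forall>i\<in>{1..k}. a p \<le> a i"
    using ex_min_if_finite[of "a ` {1..k}"] a(2) by (fastforce simp: not_less)
  have "a p \<le> a i" if "i \<in> {1..j}" for i
  proof (cases "i \<le> k")
    case False
    have "a p \<le> t" using p t(1) by auto
    then show ?thesis using bspec[OF t(2), of i] that False by simp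
  qed (use p that in auto)
  then show ?thesis using p(1) j unfolding min_before_def by blast
qed

text \<open>Since \<open>l\<close> is arbitrary, this is the inclusion of events by which no
  \<open>l\<close> does better than \<open>l = 1\<close> at selecting the value 1.\<close>

lemma selected_one_imp_min_before:
  assumes "a permutes {1..n}" "1 \<le> l" "l \<le> k" "k < n" "selected n k l a = 1"
  shows "min_before n k 1 a"
proof -
  obtain j where j: "j \<in> {k..<n}" "selected n k l a = a (Suc j)"
    "\<forall>i\<in>{Suc k..j}. threshold a k l < a i"
    by (rule selected_cases[OF assms(1-4)])
  show ?thesis
    by (rule min_beforeI[OF assms(1) _ j(1) _ threshold_in[OF assms(1-3)] j(3)]) (use assms j in auto)
qed

text \<open>For \<open>l = 1\<close> the threshold is \<open>a p\<close>. No value between positions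
  \<open>k\<close> and \<open>Suc j\<close> is below it, so the rule reaches \<open>Suc j\<close>
  and stops there.\<close>

lemma min_before_imp_selected:
  assumes a: "a permutes {1..n}" and k: "1 \<le> k" "k < n" and j: "j \<in> {k..<n}"
    and p: "p \<in> {1..k}" "\<forall>i\<in>{1..j}. a p \<le> a i" "a (Suc j) < a p"
  shows "selected n k 1 a = a (Suc j)"
proof -
  have "threshold a k 1 \<le> a p" using threshold_one_le[OF a order_refl k(1) refl p(1)] .
  moreover have "threshold a k 1 \<in> a ` {1..k}" using threshold_in[OF a order_refl k(1)] .
  moreover have "a p \<le> u" if "u \<in> a ` {1..k}" for u using that p(2) j by auto
  ultimately have t: "threshold a k 1 = a p" by (meson order_antisym)
  obtain j' where j': "j' \<in> {k..<n}" "selected n k 1 a = a (Suc j')"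
    "\<forall>i\<in>{Suc k..j'}. threshold a k 1 < a i"
    "a (Suc j') < threshold a k 1 \<or> Suc j' = n \<and> threshold a k 1 < a n"
    by (rule selected_cases[OF a order_refl k])
  have "\<not> j < j'" using bspec[OF j'(3), of "Suc j"] j p(3) t by auto
  moreover have "\<not> j' < j"
  proof
    assume "j' < j"
    then have "a p \<le> a (Suc j')" using p(2) by simp
    then show False using j'(4) j \<open>j' < j\<close> t by simp
  qed
  ultimately show ?thesis using j'(2) by simp
qed

lemma selected_one_iff:
  assumes a: "a permutes {1..n}" and k: "1 \<le> k" "k < n"
  shows "selected n k 1 a = 1 \<longleftrightarrow> min_before n k 1 a"
proof
  assume "min_before n k 1 a"
  then obtain j p where jp: "j \<in> {k..<n}" "a (Suc j) = 1" "p \<in> {1..k}" "\<forall>i\<in>{1..j}. a p \<le> a i"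
    by (auto simp: min_before_def)
  have "a p \<noteq> a (Suc j)" using inj_eq[OF permutes_inj[OF a], of p "Suc j"] jp(1,3) by simp
  moreover have "a p \<in> {1..n}" using permutes_in_image[OF a, of p] jp by auto
  ultimately show "selected n k 1 a = 1"
    using min_before_imp_selected[OF a k jp(1,3,4)] jp(2) by auto
qed (use selected_one_imp_min_before[OF a order_refl k] in simp)

lemma split_by_imp_min_before:
  assumes a: "a permutes {1..n}" and k: "1 \<le> k" "split_by n k a"
  shows "min_before n k 2 a"
proof -
  obtain p q where pq: "p \<in> {1..k}" "a p = 1" "q \<in> {Suc k..n}" "a q = 2"
    using k by (auto simp: split_by_def)
  have "a p \<le> a i" if "i \<in> {1..q - 1}" for i
    using permutes_in_image[OF a, of i] that pq by auto
  then show ?thesis using pq unfolding min_before_def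
    by (intro bexI[of _ "q - 1"] conjI bexI[of _ p]) auto
qed

text \<open>If the minimum \<open>a p\<close> were 1, then 2 coming after position \<open>k\<close>
  would give \<open>split_by\<close>. So \<open>a p\<close> exceeds 2 and the rule stops at
  2.\<close>

lemma selected_two_lower:
  assumes a: "a permutes {1..n}" and k: "1 \<le> k" "k < n"
    and m: "min_before n k 2 a" "\<not> split_by n k a"
  shows "selected n k 1 a = 2"
proof -
  obtain j p where jp: "j \<in> {k..<n}" "a (Suc j) = 2" "p \<in> {1..k}" "\<forall>i\<in>{1..j}. a p \<le> a i"
    using m by (auto simp: min_before_def)
  have "a p \<noteq> a (Suc j)" using inj_eq[OF permutes_inj[OF a], of p "Suc j"] jp(1,3) by simp
  moreover have "a p \<in> {1..n}" using permutes_in_image[OF a, of p] jp by auto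
  moreover have "a p \<noteq> 1"
    using m(2) jp by (auto simp: split_by_def)
  ultimately show ?thesis
    using min_before_imp_selected[OF a k jp(1,3,4)] jp(2) by auto
qed

text \<open>Stopping at 2 because it is below the threshold means that 1 is not among the first
  \<open>k\<close> values; otherwise the stop was forced and \<open>a n = 2\<close>.\<close>

lemma selected_two_upper:
  assumes a: "a permutes {1..n}" and k: "1 \<le> k" "k < n" and s: "selected n k 1 a = 2"
  shows "min_before n k 2 a \<and> \<not> split_by n k a \<or> a n = 2"
proof -
  obtain j where j: "j \<in> {k..<n}" "selected n k 1 a = a (Suc j)"
    "\<forall>i\<in>{Suc k..j}. threshold a k 1 < a i"
    "a (Suc j) < threshold a k 1 \<or> Suc j = n \<and> threshold a k 1 < a n"
    by (rule selected_cases[OF a order_refl k])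
  have "min_before n k 2 a"
    using j s k by (intro min_beforeI[OF a k(1) j(1) _ threshold_in[OF a order_refl k(1)]]) auto
  moreover have "\<not> split_by n k a" if "2 < threshold a k 1"
  proof
    assume "split_by n k a"
    then obtain p where "p \<in> {1..k}" "a p = 1" by (auto simp: split_by_def)
    then show False using threshold_one_le[OF a order_refl k(1) refl, of p] that by simp
  qed
  ultimately show ?thesis using j(2,4) s by auto
qed

text \<open>For \<open>l \<ge> 2\<close> the threshold is at least the second smallest of the first
  \<open>k\<close> values. All values passed over exceed it, so the two smallest of the first
  \<open>k\<close> remain the two smallest of the first \<open>j\<close>.\<close>

lemma selected_imp_two_min_before:
  assumes a: "a permutes {1..n}" and l: "2 \<le> l" "l \<le> k" "k < n"
    and s: "selected n k l a = v"
  shows "two_min_before n k v a"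
proof -
  have l1: "1 \<le> l" using l by simp
  obtain j where j: "j \<in> {k..<n}" "selected n k l a = a (Suc j)"
    "\<forall>i\<in>{Suc k..j}. threshold a k l < a i"
    by (rule selected_cases[OF a l1 l(2,3)])
  obtain r where r: "r \<in> {1..k}" "threshold a k l = a r"
    using threshold_in[OF a l1 l(2)] by auto
  obtain u where u: "u \<in> {1..k}" "a u < threshold a k l"
    using below_threshold[OF a l1 l(2,1)] by auto
  have "\<exists>!x. x \<in> {1..k} \<times> {1..k} - Id \<and> two_min_at a k x"
    using permutes_inj[OF a] l by (intro two_min_at_unique) auto
  then obtain x where x: "x \<in> {1..k} \<times> {1..k} - Id" "two_min_at a k x" by blast
  obtain p q where "x = (p, q)" by (rule prod.exhaust)
  with x have pq: "(p, q) \<in> {1..k} \<times> {1..k} - Id" "two_min_at a k (p, q)" by simp_all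
  \<comment> \<open>Only position \<open>p\<close> carries a value below \<open>a q\<close> among
    the first \<open>k\<close>, but otherwise \<open>r\<close> and \<open>u\<close> would be two
    such positions.\<close>
  have "a q \<le> a r"
  proof (rule ccontr)
    assume "\<not> a q \<le> a r"
    then have "a r < a q" "a u < a q" using u r by auto
    moreover have "i = p" if "i \<in> {1..k}" "a i < a q" for i
    proof (rule ccontr)
      assume "i \<noteq> p"
      then have "i \<in> {1..k} - {p, q}" using that by auto
      then have "a q < a i" using pq(2) unfolding two_min_at_def by blast
      then show False using that(2) by simp
    qed
    ultimately have "r = p" "u = p" using u(1) r(1) by blast+
    then show False using u r by simp
  qed
  have "two_min_at a j (p, q)"
  proof -
    have "a q < a i" if "i \<in> {1..j} - {p, q}" for i
      using pq(2) bspec[OF j(3), of i] \<open>a q \<le> a r\<close> r(2) that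
      by (cases "i \<le> k") (auto simp: two_min_at_def)
    then show ?thesis using pq(2) by (auto simp: two_min_at_def)
  qed
  then have "\<exists>x\<in>{1..k} \<times> {1..k} - Id. two_min_at a j x" using pq(1) by (rule bexI)
  then show ?thesis using j(1,2) s unfolding two_min_before_def by (intro bexI[of _ j] conjI) simp_all
qed

subsection \<open>Analytic estimates\<close>

text \<open>Induction on \<open>n\<close> with
  \<open>1 / (n + 1) \<le> ln ((n + 1) / n) \<le> 1 / n\<close>; the surplus in the upper bound
  telescopes.\<close>

lemma sum_inverse_bounds:
  assumes "1 \<le> k" "k \<le> n"
  shows "ln (n / k) \<le> (\<Sum>j=k..<n. 1 / real j)"
    and "(\<Sum>j=k..<n. 1 / real j) \<le> ln (n / k) + 1 / real k - 1 / real n"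
proof -
  have "ln (n / k) \<le> (\<Sum>j=k..<n. 1 / real j) \<and>
        (\<Sum>j=k..<n. 1 / real j) \<le> ln (n / k) + 1 / real k - 1 / real n"
    using assms(2)
  proof (induction n rule: dec_induct)
    case base
    then show ?case using assms(1) by simp
  next
    case (step n)
    have n: "real n > 0" using assms(1) step by simp
    have k: "real k > 0" using assms(1) by simp
    have 1: "ln (real (Suc n) / k) = ln (real n / k) + ln (real (Suc n) / n)"
      using n k by (simp add: ln_div)
    have "ln (real (Suc n) / n) \<le> real (Suc n) / n - 1"
      using n by (intro ln_le_minus_one) simp
    also have "\<dots> = 1 / real n" using n by (simp add: field_simps)
    finally have 2: "ln (real (Suc n) / n) \<le> 1 / real n" .
    have "ln (n / real (Suc n)) \<le> n / real (Suc n) - 1"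
      using n by (intro ln_le_minus_one) simp
    also have "\<dots> = - (1 / real (Suc n))" by (simp add: field_simps)
    finally have 3: "ln (real (Suc n) / n) \<ge> 1 / real (Suc n)" using n by (simp add: ln_div)
    show ?case using step.IH step.hyps 1 2 3 by simp
  qed
  then show "ln (n / k) \<le> (\<Sum>j=k..<n. 1 / real j)"
    and "(\<Sum>j=k..<n. 1 / real j) \<le> ln (n / k) + 1 / real k - 1 / real n" by blast+
qed

text \<open>This is \<open>ln y \<le> y - 1\<close> at \<open>y = 1 / (exp 1 * x)\<close>, which is
  sharp at \<open>x = 1 / exp 1\<close>.\<close>

lemma neg_x_ln_x_le: "- x * ln x \<le> 1 / exp 1" if "x > 0" for x :: real
proof -
  have "ln (1 / (exp 1 * x)) \<le> 1 / (exp 1 * x) - 1"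
    using that by (intro ln_le_minus_one) simp
  then have "- ln x \<le> 1 / (exp 1 * x)" using that by (simp add: ln_div ln_mult)
  then have "x * (- ln x) \<le> x * (1 / (exp 1 * x))" using that by (intro mult_left_mono) auto
  then show ?thesis using that by simp
qed

text \<open>The derivative \<open>?h\<close> of \<open>?G\<close> vanishes at \<open>z\<close> by
  the root equation and is nonincreasing on \<open>(0, 1]\<close>, so \<open>?G\<close> rises up to
  \<open>z\<close> and falls afterwards.\<close>

lemma quadratic_minus_x_ln_x_le:
  fixes x z :: real
  assumes z: "0 < z" "z < 1" "2 * z - 2 * ln z = 3" and x: "0 < x" "x \<le> 1"
  shows "- 2 * x * ln x - x * (1 - x) \<le> 2 * z - z\<^sup>2"
proof -
  let ?G = "\<lambda>x::real. - 2 * x * ln x - x * (1 - x)"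
  let ?h = "\<lambda>x::real. 2 * x - 2 * ln x - 3"
  have deriv: "(?G has_real_derivative ?h u) (at u)" if "u > 0" for u
    using that by (auto intro!: derivative_eq_intros simp: field_simps)
  have mono: "?h v \<le> ?h u" if "0 < u" "u \<le> v" "v \<le> 1" for u v
  proof -
    have "ln (u / v) \<le> u / v - 1" using that by (intro ln_le_minus_one) simp
    also have "\<dots> = - ((v - u) / v)" using that by (simp add: field_simps)
    also have "\<dots> \<le> - (v - u)"
    proof -
      have "(v - u) * 1 \<le> (v - u) * (1 / v)" using that by (intro mult_left_mono) auto
      then show ?thesis by simp
    qed
    finally show ?thesis using that by (simp add: ln_div)
  qed
  have "?G x \<le> ?G z"
  proof (cases "x \<le> z")
    case True
    show ?thesis
    proof (rule DERIV_nonneg_imp_nondecreasing[OF True])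
      fix u assume "x \<le> u" "u \<le> z"
      then have "(?G has_real_derivative ?h u) (at u)" "0 \<le> ?h u"
        using deriv[of u] mono[of u z] z x by auto
      then show "\<exists>y. (?G has_real_derivative y) (at u) \<and> 0 \<le> y" by blast
    qed
  next
    case False
    then have "z \<le> x" by simp
    show ?thesis
    proof (rule DERIV_nonpos_imp_nonincreasing[OF \<open>z \<le> x\<close>])
      fix u assume "z \<le> u" "u \<le> x"
      then have "(?G has_real_derivative ?h u) (at u)" "?h u \<le> 0"
        using deriv[of u] mono[of z u] z x by auto
      then show "\<exists>y. (?G has_real_derivative y) (at u) \<and> y \<le> 0" by blast
    qed
  qed
  \<comment> \<open>The root equation replaces \<open>- (2 * ln z)\<close> by
    \<open>3 - 2 * z\<close>, which removes the logarithm.\<close>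
  also have "?G z = z * (- (2 * ln z)) - z * (1 - z)" by simp
  also have "\<dots> = z * (3 - 2 * z) - z * (1 - z)"
    using z(3) by (metis add_diff_cancel_left' add.commute diff_minus_eq_add uminus_add_conv_diff)
  also have "\<dots> = 2 * z - z\<^sup>2" by (simp add: power2_eq_square algebra_simps)
  finally show ?thesis .
qed

section \<open>Numerical values and the roots of the equation\<close>

lemma exp_minus_one_approx: "\<bar>1 / exp 1 - 0.36788\<bar> \<le> (0.000005 :: real)"
proof -
  have "\<bar>exp 1 - 5837465777 / 2147483648\<bar> \<le> (1 / 4294967296 :: real)"
    using e_approx_32 by (simp add: inverse_eq_divide)
  then have "5837465777 / 2147483648 - 1 / 4294967296 \<le> exp (1::real)"
    "exp (1::real) \<le> 5837465777 / 2147483648 + 1 / 4294967296" unfolding abs_le_iff by linarith+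
  then have e: "2.718281 \<le> exp (1::real)" "exp (1::real) \<le> 2.718282" by simp_all
  then have "1 / 2.718282 \<le> 1 / exp (1::real)" "1 / exp (1::real) \<le> 1 / 2.718281"
    by (intro divide_left_mono; simp)+
  then show ?thesis unfolding abs_le_iff by simp
qed

text \<open>The two points are close enough together to determine \<open>2 * x - x\<^sup>2\<close>
  within 0.000005 of 0.51239 for the root \<open>x\<close> between them.\<close>

lemma ln_root_bracket:
  "2 * 0.301706 - 2 * ln (0.301706 :: real) > 3"
  "2 * 0.301712 - 2 * ln (0.301712 :: real) < 3"
proof -
  \<comment> \<open>\<open>1 / 0.3017\<close> is close to \<open>(4/3)\<^sup>4 * 1.0487\<close>, and the series for the logarithms of both factors converge fast.\<close>
  have ln43: "0.2876817 \<le> ln (4/3 :: real)" "ln (4/3 :: real) \<le> 0.2876823"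
    using ln_approx_bounds[of "4/3" 3] by (simp_all add: eval_nat_numeral)
  have pow: "ln ((4/3) ^ 4 :: real) = 4 * ln (4/3)"
    by (subst ln_realpow) simp_all
  have "ln (1.04872 :: real) \<ge> 0.047570"
    using ln_approx_bounds[of "1.04872" 2] by (simp add: eval_nat_numeral)
  then have "1.198296 \<le> ln ((4/3) ^ 4 :: real) + ln 1.04872"
    unfolding pow using ln43 by simp
  also have "\<dots> = ln ((4/3) ^ 4 * 1.04872)" by (rule ln_mult_pos[symmetric]) simp_all
  also have "\<dots> \<le> ln (1 / 0.301706)" by (subst ln_le_cancel_iff) (simp_all add: power_divide)
  also have "\<dots> = - ln 0.301706" by (subst ln_div) simp_all
  finally show "2 * 0.301706 - 2 * ln (0.301706 :: real) > 3" by simp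
  have "- ln 0.301712 = ln (1 / 0.301712 :: real)" by (subst ln_div) simp_all
  also have "\<dots> \<le> ln ((4/3) ^ 4 * 1.048705)" by (subst ln_le_cancel_iff) (simp_all add: power_divide)
  also have "\<dots> = ln ((4/3) ^ 4) + ln 1.048705" by (rule ln_mult_pos) simp_all
  also have "\<dots> \<le> 1.198287"
  proof -
    have "ln (1.048705 :: real) \<le> 0.047557"
      using ln_approx_bounds[of "1.048705" 2] by (simp add: eval_nat_numeral)
    then show ?thesis unfolding pow using ln43 by simp
  qed
  finally show "2 * 0.301712 - 2 * ln (0.301712 :: real) < 3" by simp
qed

text \<open>The function \<open>?f\<close> strictly decreases on \<open>(0, 1]\<close> and strictly
  increases from 1 on, and its value at 1 is 2, below 3. So there is exactly one root on each side
  of 1.\<close>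

lemma root_equation_solutions:
  obtains x y :: real where "0.301706 < x" "x < 0.301712" "1 < y"
    "2 * x - 2 * ln x = 3" "{z. 0 < z \<and> 2 * z - 2 * ln z = 3} = {x, y}"
proof -
  let ?f = "\<lambda>z::real. 2 * z - 2 * ln z"
  have deriv: "(?f has_real_derivative 2 - 2 / u) (at u)" if "u > 0" for u
    using that by (auto intro!: derivative_eq_intros simp: field_simps)
  have dec: "?f v < ?f u" if "0 < u" "u < v" "v \<le> 1" for u v
  proof (rule DERIV_neg_imp_decreasing_open[OF \<open>u < v\<close>])
    fix w assume w: "u < w" "w < v"
    then have "2 - 2 / w < 0" using that by (simp add: field_simps)
    then show "\<exists>y. (?f has_real_derivative y) (at w) \<and> y < 0" using deriv[of w] w that by auto
  qed (use that in \<open>auto intro!: continuous_intros\<close>)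
  have inc: "?f u < ?f v" if "1 \<le> u" "u < v" for u v
  proof (rule DERIV_pos_imp_increasing_open[OF \<open>u < v\<close>])
    fix w assume w: "u < w" "w < v"
    then have "2 - 2 / w > 0" using that by (simp add: field_simps)
    then show "\<exists>y. (?f has_real_derivative y) (at w) \<and> y > 0" using deriv[of w] w that by auto
  qed (use that in \<open>auto intro!: continuous_intros\<close>)
  have "\<exists>x\<ge>0.301706. x \<le> 0.301712 \<and> ?f x = 3"
    using ln_root_bracket by (intro IVT2') (auto intro!: continuous_intros)
  then obtain x where x: "0.301706 \<le> x" "x \<le> 0.301712" "?f x = 3" by blast
  have ln4: "ln 4 < (2::real)"
  proof -
    have "ln (4::real) = 2 * ln 2" using ln_realpow[of "2::real" 2] by simp
    then show ?thesis using ln_2_less_1 by simp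
  qed
  \<comment> \<open>At the right endpoint, \<open>ln 4 < 2\<close> gives
    \<open>?f 4 > 4\<close>.\<close>
  have "\<exists>y\<ge>1. y \<le> 4 \<and> ?f y = 3"
    using ln4 by (intro IVT') (auto intro!: continuous_intros)
  then obtain y where y: "1 \<le> y" "?f y = 3" by blast
  have "y \<noteq> 1" using y by auto
  have uniq: "z = x \<or> z = y" if "0 < z" "?f z = 3" for z
  proof (cases "z \<le> 1")
    case True
    then show ?thesis
      using dec[of z x] dec[of x z] x that by (cases z x rule: linorder_cases) auto
  next
    case False
    then show ?thesis
      using inc[of z y] inc[of y z] y that by (cases z y rule: linorder_cases) auto
  qed
  have "{z. 0 < z \<and> ?f z = 3} = {x, y}" using uniq x y by auto
  moreover have "x \<noteq> 0.301706" "x \<noteq> 0.301712" using ln_root_bracket x(3) by (metis less_irrefl)+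
  ultimately show thesis
    using that[of x y] x y \<open>y \<noteq> 1\<close> by auto
qed

subsection \<open>Asymptotics of the reward\<close>

lemma expected_reward_eq:
  assumes "1 \<le> l" "l \<le> k" "k < n"
  shows "expected_reward n d k l =
    (\<Sum>v=1..d. (real n + 1 - real v) * perm_prob n (\<lambda>a. selected n k l a = v))"
proof -
  let ?A = "{a. a permutes {1..n}}"
  have fin: "finite ?A" by (simp add: finite_permutations)
  \<comment> \<open>That \<open>s\<close> is positive matters: \<open>reward\<close> would pay
    \<open>n + 1\<close> at 0, which the sum from 1 misses.\<close>
  have reward: "reward n d s = (\<Sum>v=1..d. if s = v then real n + 1 - real v else 0)" if "s \<in> {1..n}" for s
    using that by (simp add: reward_def sum.delta')
  have "expected_reward n d k l = (\<Sum>a\<in>?A. reward n d (selected n k l a)) / fact n"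
    unfolding expected_reward_def
  proof (subst integral_pmf_of_set)
    show "?A \<noteq> {}" using permutes_id by blast
  qed (use fin card_permutations[of "{1..n}" n] in simp_all)
  also have "(\<Sum>a\<in>?A. reward n d (selected n k l a)) =
      (\<Sum>a\<in>?A. \<Sum>v=1..d. if selected n k l a = v then real n + 1 - real v else 0)"
    using selected_in[OF _ assms] by (intro sum.cong refl reward) auto
  also have "\<dots> = (\<Sum>v=1..d. \<Sum>a\<in>?A. if selected n k l a = v then real n + 1 - real v else 0)"
    by (rule sum.swap)
  also have "\<dots> = (\<Sum>v=1..d. (real n + 1 - real v) * card {a. a permutes {1..n} \<and> selected n k l a = v})"
    using fin by (intro sum.cong refl) (simp add: sum.If_cases Int_def)
  finally show ?thesis by (simp add: perm_prob_def sum_divide_distrib)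
qed

lemma expected_reward_one:
  assumes "1 \<le> l" "l \<le> k" "k < n"
  shows "expected_reward n 1 k l / n = perm_prob n (\<lambda>a. selected n k l a = 1)"
  using assms by (subst expected_reward_eq[OF assms]) simp

lemma expected_reward_two:
  assumes "1 \<le> l" "l \<le> k" "k < n"
  shows "expected_reward n 2 k l / n = perm_prob n (\<lambda>a. selected n k l a = 1) +
           (1 - 1 / n) * perm_prob n (\<lambda>a. selected n k l a = 2)"
proof -
  have "{1..2::nat} = {1, 2}" by auto
  then show ?thesis
    using assms by (subst expected_reward_eq[OF assms]) (simp add: field_simps)
qed

text \<open>The error \<open>1 / k\<close> of the harmonic estimate is multiplied by
  \<open>k / n\<close>, which leaves \<open>1 / n\<close> uniformly in \<open>k\<close>.\<close>

lemma perm_prob_min_before_bounds: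
  assumes "1 \<le> k" "k < n" "v \<in> {1..n}"
  defines "x \<equiv> real k / real n"
  shows "- x * ln x \<le> perm_prob n (min_before n k v)"
    and "perm_prob n (min_before n k v) \<le> - x * ln x + 1 / n"
proof -
  have A: "perm_prob n (min_before n k v) = x * (\<Sum>j=k..<n. 1 / real j)"
    using perm_prob_min_before[OF assms(1,3)] by (simp add: x_def)
  have x: "0 < x" "x < 1" using assms by (simp_all add: x_def)
  have ln: "ln (n / k) = - ln x" using assms by (simp add: x_def ln_div)
  have "x * ln (n / k) \<le> x * (\<Sum>j=k..<n. 1 / real j)"
    using x assms by (intro mult_left_mono sum_inverse_bounds) auto
  then show "- x * ln x \<le> perm_prob n (min_before n k v)" by (simp add: A ln)
  have "x * (\<Sum>j=k..<n. 1 / real j) \<le> x * (ln (n / k) + 1 / real k - 1 / real n)"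
    using x assms by (intro mult_left_mono sum_inverse_bounds) auto
  also have "\<dots> = - x * ln x + x * (1 / k) - x / n" by (simp add: ln algebra_simps)
  also have "x * (1 / k) = 1 / n" using assms by (simp add: x_def)
  also have "- x * ln x + 1 / n - x / n \<le> - x * ln x + 1 / n" using x by simp
  finally show "perm_prob n (min_before n k v) \<le> - x * ln x + 1 / n" unfolding A .
qed

lemma perm_prob_selected_one_le:
  assumes "1 \<le> l" "l \<le> k" "k < n"
  shows "perm_prob n (\<lambda>a. selected n k l a = 1) \<le> perm_prob n (min_before n k 1)"
  using selected_one_imp_min_before[OF _ assms] by (rule perm_prob_mono)

lemma perm_prob_selected_one:
  assumes "1 \<le> k" "k < n"
  shows "perm_prob n (\<lambda>a. selected n k 1 a = 1) = perm_prob n (min_before n k 1)"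
  using selected_one_iff[OF _ assms] by (rule perm_prob_cong)

lemma perm_prob_selected_two:
  assumes "1 \<le> k" "k < n"
  defines "D \<equiv> perm_prob n (min_before n k 2) - perm_prob n (split_by n k)"
  shows "D \<le> perm_prob n (\<lambda>a. selected n k 1 a = 2)"
    and "perm_prob n (\<lambda>a. selected n k 1 a = 2) \<le> D + 1 / n"
proof -
  have D: "perm_prob n (\<lambda>a. min_before n k 2 a \<and> \<not> split_by n k a) = D"
    unfolding D_def using split_by_imp_min_before[OF _ assms(1)] by (rule perm_prob_diff)
  show "D \<le> perm_prob n (\<lambda>a. selected n k 1 a = 2)"
    unfolding D[symmetric] using selected_two_lower[OF _ assms(1,2)] by (intro perm_prob_mono) auto
  have "perm_prob n (\<lambda>a. selected n k 1 a = 2) \<le>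
      perm_prob n (\<lambda>a. (min_before n k 2 a \<and> \<not> split_by n k a) \<or> a n = 2)"
    using selected_two_upper[OF _ assms(1,2)] by (rule perm_prob_mono)
  also have "\<dots> \<le> D + perm_prob n (\<lambda>a. a n = 2)"
    unfolding D[symmetric] by (rule perm_prob_Un_le)
  also have "perm_prob n (\<lambda>a. a n = 2) = 1 / n"
    using assms(1,2) by (intro perm_prob_eq_at) auto
  finally show "perm_prob n (\<lambda>a. selected n k 1 a = 2) \<le> D + 1 / n" .
qed

text \<open>The values 1 and 2 contribute about \<open>- x * ln x\<close> each, less the cost of
  \<open>split_by\<close>. In the upper bound two errors \<open>1 / n\<close> come from
  \<open>A\<close> and one from the event \<open>a n = 2\<close>.\<close>

lemma expected_reward_two_bounds:
  assumes k: "1 \<le> k" "k < n"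
  defines "x \<equiv> real k / real n"
  defines "G \<equiv> - 2 * x * ln x - x * (1 - x)"
  shows "G - 1 / n \<le> expected_reward n 2 k 1 / n"
    and "expected_reward n 2 k 1 / n \<le> G + 3 / n"
proof -
  define A where "A = perm_prob n (min_before n k 1)"
  define r where "r = 1 / real n"
  have n: "n \<ge> 2" using k by simp
  have x: "0 < x" "x < 1" using k by (simp_all add: x_def)
  have r: "0 < r" "r < 1" using n by (simp_all add: r_def)
  have A2: "perm_prob n (min_before n k 2) = A"
    unfolding A_def using n k by (simp add: perm_prob_min_before)
  have A: "- x * ln x \<le> A" "A \<le> - x * ln x + r"
    using perm_prob_min_before_bounds[OF k, of 1] n by (simp_all add: A_def x_def r_def)
  \<comment> \<open>The factor \<open>(n - 1) / n\<close> from the smaller reward for 2 cancels the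
    \<open>n - 1\<close> in the probability, so this term is exact.\<close>
  have S: "(1 - r) * perm_prob n (split_by n k) = x * (1 - x)"
    using n k by (simp add: perm_prob_split_by x_def r_def divide_simps)
  have E: "expected_reward n 2 k 1 / n = A + (1 - r) * perm_prob n (\<lambda>a. selected n k 1 a = 2)"
    using expected_reward_two[OF order_refl k] perm_prob_selected_one[OF k] by (simp add: A_def r_def)
  \<comment> \<open>A crude bound is enough: it shows that replacing \<open>1 - r\<close> by 1 costs
    at most \<open>r\<close>.\<close>
  have g: "- x * ln x \<le> 1"
  proof -
    have "- x * ln x \<le> 1 / exp 1" by (rule neg_x_ln_x_le[OF x(1)])
    also have "\<dots> \<le> 1" by simp
    finally show ?thesis .
  qed
  have "(1 - r) * (A - perm_prob n (split_by n k)) \<le> (1 - r) * perm_prob n (\<lambda>a. selected n k 1 a = 2)"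
    using perm_prob_selected_two(1)[OF k] r A2 by (intro mult_left_mono) auto
  then have "A + (1 - r) * A - x * (1 - x) \<le> expected_reward n 2 k 1 / n"
    unfolding E S[symmetric] by (simp add: algebra_simps)
  moreover have "(1 - r) * (- x * ln x) \<le> (1 - r) * A"
    using A r by (intro mult_left_mono) auto
  moreover have "r * (- x * ln x) \<le> r * 1" using g r by (intro mult_left_mono) auto
  ultimately show "G - 1 / n \<le> expected_reward n 2 k 1 / n"
    using A by (simp add: G_def r_def[symmetric] algebra_simps)
  have "0 \<le> A" by (simp add: A_def perm_prob_def)
  have "(1 - r) * perm_prob n (\<lambda>a. selected n k 1 a = 2) \<le> (1 - r) * (A - perm_prob n (split_by n k) + r)"
    using perm_prob_selected_two(2)[OF k] r A2 by (intro mult_left_mono) (auto simp: r_def)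
  also have "\<dots> = A - r * A - x * (1 - x) + r - r * r"
    unfolding S[symmetric] by (simp add: algebra_simps)
  finally have "expected_reward n 2 k 1 / n \<le> A + A - x * (1 - x) + r"
    using E r \<open>0 \<le> A\<close> by (smt (verit) mult_nonneg_nonneg)
  then have "expected_reward n 2 k 1 / n \<le> G + 3 * r"
    using A by (simp add: G_def)
  then show "expected_reward n 2 k 1 / n \<le> G + 3 / n" by (simp add: r_def)
qed

text \<open>Each of the two values is selected with probability at most \<open>B\<close>, and
  \<open>4 * k * (n - k) \<le> n\<^sup>2\<close> bounds \<open>2 * B\<close> by
  \<open>n / (2 * (n - 1))\<close>.\<close>

lemma expected_reward_two_le_half:
  assumes "2 \<le> l" "l \<le> k" "k < n"
  shows "expected_reward n 2 k l / n \<le> 1 / 2 + 1 / n"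
proof -
  define B where "B = k * (real n - k) / (n * (real n - 1))"
  have n: "real n \<ge> 3" using assms by simp
  have B0: "B \<ge> 0" using assms by (auto simp: B_def intro!: divide_nonneg_nonneg mult_nonneg_nonneg)
  have le: "perm_prob n (\<lambda>a. selected n k l a = v) \<le> B" if "v \<in> {1, 2}" for v
  proof -
    have "perm_prob n (\<lambda>a. selected n k l a = v) \<le> perm_prob n (two_min_before n k v)"
      using selected_imp_two_min_before[OF _ assms] that by (intro perm_prob_mono) auto
    then show ?thesis
      using perm_prob_two_min_before[of k n v] assms that by (auto simp: B_def)
  qed
  have "expected_reward n 2 k l / n = perm_prob n (\<lambda>a. selected n k l a = 1) +
           (1 - 1 / n) * perm_prob n (\<lambda>a. selected n k l a = 2)"
    using assms by (intro expected_reward_two) auto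
  also have "\<dots> \<le> B + 1 * B"
    using le n by (intro add_mono mult_mono) (auto simp: perm_prob_def)
  also have "\<dots> \<le> 1 / 2 + 1 / n"
  proof -
    have "0 \<le> (2 * real k - n)\<^sup>2" by simp
    then have "4 * (k * (real n - k)) \<le> real n * n"
      by (simp add: power2_eq_square algebra_simps)
    then have "B \<le> (real n * n / 4) / (n * (real n - 1))"
      unfolding B_def using n by (intro divide_right_mono) auto
    also have "\<dots> = n / (4 * (real n - 1))" using n by (simp add: divide_simps)
    finally have "B + 1 * B \<le> 2 * (n / (4 * (real n - 1)))" by simp
    also have "\<dots> = n / (2 * (real n - 1))" using n by (simp add: divide_simps)
    also have "\<dots> \<le> 1 / 2 + 1 / n"
    proof -
      have "n / (2 * (real n - 1)) - 1 / 2 = 1 / (2 * (real n - 1))" using n by (simp add: divide_simps)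
      also have "\<dots> \<le> 1 / n" using n by (intro divide_left_mono) auto
      finally show ?thesis by simp
    qed
    finally show ?thesis .
  qed
  finally show ?thesis .
qed

text \<open>A squeeze: \<open>upper\<close> bounds all rules at once, while \<open>lower\<close> is
  applied to \<open>l = 1\<close> and \<open>k\<close> the floor of \<open>z * n\<close>, for which
  \<open>k / n\<close> tends to \<open>z\<close>.\<close>

lemma max_reward_over_n_tendsto:
  fixes G :: "real \<Rightarrow> real"
  assumes upper: "\<And>n k l. 1 \<le> l \<Longrightarrow> l \<le> k \<Longrightarrow> k < n \<Longrightarrow> expected_reward n d k l / n \<le> G z + C / n"
    and lower: "\<And>n k. 1 \<le> k \<Longrightarrow> k < n \<Longrightarrow> G (k / n) - C / n \<le> expected_reward n d k 1 / n"
    and z: "0 < z" "z < 1" and cont: "isCont G z"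
  shows "(\<lambda>n. max_reward n d / n) \<longlonglongrightarrow> G z"
proof -
  define k where "k = (\<lambda>n::nat. nat \<lfloor>z * n\<rfloor>)"
  let ?S = "\<lambda>n. {expected_reward n d k l |k l. 1 \<le> l \<and> l \<le> k \<and> k \<le> n - 1}"
  have fin: "finite (?S n)" for n
  proof (rule finite_subset)
    show "?S n \<subseteq> (\<lambda>(k, l). expected_reward n d k l) ` ({..n} \<times> {..n})" by force
  qed simp
  have C: "(\<lambda>n. C / real n) \<longlonglongrightarrow> 0" by (rule lim_const_over_n)
  have "(\<lambda>n. real (k n) / n) \<longlonglongrightarrow> z"
  proof (rule tendsto_sandwich)
    show "\<forall>\<^sub>F n in sequentially. z - 1 / n \<le> real (k n) / n"
      using eventually_gt_at_top[of 0]
    proof eventually_elim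
      case (elim n)
      have "z * n - 1 \<le> real (k n)" using z unfolding k_def by linarith
      then have "(z * n - 1) / n \<le> real (k n) / n" by (rule divide_right_mono) simp
      then show ?case using elim by (simp add: diff_divide_distrib)
    qed
    show "\<forall>\<^sub>F n in sequentially. real (k n) / n \<le> z"
      using eventually_gt_at_top[of 0]
    proof eventually_elim
      case (elim n)
      have "0 \<le> z * n" using z by simp
      then have "real (k n) \<le> z * n" unfolding k_def by linarith
      then show ?case using elim by (simp add: field_simps)
    qed
    show "(\<lambda>n. z - 1 / real n) \<longlonglongrightarrow> z" using tendsto_diff[OF tendsto_const lim_1_over_n, of z] by simp
  qed simp
  then have "(\<lambda>n. G (real (k n) / n) - C / n) \<longlonglongrightarrow> G z - 0"
    by (intro tendsto_diff C isCont_tendsto_compose[OF cont])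
  then have lo: "(\<lambda>n. G (real (k n) / n) - C / n) \<longlonglongrightarrow> G z" by simp
  have hi: "(\<lambda>n. G z + C / n) \<longlonglongrightarrow> G z" using tendsto_add[OF tendsto_const C, of "G z"] by simp
  \<comment> \<open>\<open>n \<ge> 1 / z\<close> makes the chosen \<open>k\<close> positive, and
    \<open>z < 1\<close> keeps it below \<open>n\<close>; so the set in \<open>max_reward\<close> is
    nonempty and contains the chosen rule.\<close>
  have ev: "\<forall>\<^sub>F n in sequentially. 1 \<le> k n \<and> k n < n \<and> n \<ge> 2"
    using eventually_ge_at_top[of "nat \<lceil>1 / z\<rceil>"] eventually_ge_at_top[of 2]
  proof eventually_elim
    case (elim n)
    have "1 / z \<le> n" using elim by linarith
    then have "1 \<le> z * n" using z by (simp add: field_simps)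
    moreover have "z * n < n" using z elim by simp
    ultimately show ?case using elim unfolding k_def by linarith
  qed
  show ?thesis
  proof (rule tendsto_sandwich[OF _ _ lo hi])
    show "\<forall>\<^sub>F n in sequentially. G (real (k n) / n) - C / n \<le> max_reward n d / n"
      using ev
    proof eventually_elim
      case (elim n)
      have "expected_reward n d (k n) 1 \<in> ?S n" using elim by force
      then have "expected_reward n d (k n) 1 \<le> max_reward n d"
        unfolding max_reward_def by (rule Max_ge[OF fin])
      then have "expected_reward n d (k n) 1 / n \<le> max_reward n d / n" by (simp add: divide_right_mono)
      then show ?case using lower[of "k n" n] elim by linarith
    qed
    show "\<forall>\<^sub>F n in sequentially. max_reward n d / n \<le> G z + C / n"
      using ev
    proof eventually_elim
      case (elim n)
      have "?S n \<noteq> {}" using elim by force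
      then have "max_reward n d \<in> ?S n" unfolding max_reward_def by (rule Max_in[OF fin])
      then obtain k' l where "max_reward n d = expected_reward n d k' l" "1 \<le> l" "l \<le> k'" "k' \<le> n - 1"
        by blast
      then show ?case using upper[of l k' n] elim by simp
    qed
  qed
qed

lemma max_reward_one_tendsto: "(\<lambda>n. max_reward n 1 / n) \<longlonglongrightarrow> 1 / exp 1"
proof -
  let ?G = "\<lambda>x::real. - x * ln x"
  have G: "?G (1 / exp 1) = 1 / exp 1" by (simp add: ln_div)
  have "(\<lambda>n. max_reward n 1 / n) \<longlonglongrightarrow> ?G (1 / exp 1)"
  proof (rule max_reward_over_n_tendsto[where C = 1 and G = ?G and z = "1 / exp 1"])
    fix n k l :: nat assume kl: "1 \<le> l" "l \<le> k" "k < n"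
    then have "expected_reward n 1 k l / n \<le> perm_prob n (min_before n k 1)"
      using expected_reward_one perm_prob_selected_one_le by simp
    also have "\<dots> \<le> ?G (k / n) + 1 / n"
      using kl by (intro perm_prob_min_before_bounds) auto
    also have "\<dots> \<le> ?G (1 / exp 1) + 1 / n"
      unfolding G using neg_x_ln_x_le[of "k / n"] kl by simp
    finally show "expected_reward n 1 k l / n \<le> ?G (1 / exp 1) + 1 / n" .
  next
    fix n k :: nat assume k: "1 \<le> k" "k < n"
    then have "expected_reward n 1 k 1 / n = perm_prob n (min_before n k 1)"
      using expected_reward_one[of 1 k n] perm_prob_selected_one by simp
    moreover have "?G (k / n) \<le> perm_prob n (min_before n k 1)"
      using k by (intro perm_prob_min_before_bounds) auto
    moreover have "0 \<le> 1 / real n" by simp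
    ultimately show "?G (k / n) - 1 / n \<le> expected_reward n 1 k 1 / n" by linarith
  qed (auto intro!: continuous_intros)
  then show ?thesis unfolding G .
qed

lemma max_reward_two_tendsto:
  assumes z: "0.301706 < z" "z < 1" "2 * z - 2 * ln z = 3"
  shows "(\<lambda>n. max_reward n 2 / n) \<longlonglongrightarrow> 2 * z - z\<^sup>2"
proof -
  let ?G = "\<lambda>x::real. - 2 * x * ln x - x * (1 - x)"
  have "2 * ln z = 2 * z - 3" using z(3) by simp
  then have "?G z = - z * (2 * z - 3) - z * (1 - z)"
    by (metis mult.assoc mult.left_commute mult_minus_left)
  then have G: "?G z = 2 * z - z\<^sup>2" by (simp add: power2_eq_square algebra_simps)
  \<comment> \<open>The lower bound on \<open>z\<close> enters here: it puts the claimed limit above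
    the \<open>1 / 2\<close> that rules with \<open>l \<ge> 2\<close> can reach.\<close>
  have half: "1 / 2 \<le> 2 * z - z\<^sup>2"
  proof -
    have "(1 - z)\<^sup>2 \<le> 0.698294\<^sup>2" using z by (intro power_mono) auto
    then show ?thesis by (simp add: power2_eq_square algebra_simps)
  qed
  have "(\<lambda>n. max_reward n 2 / n) \<longlonglongrightarrow> ?G z"
  proof (rule max_reward_over_n_tendsto[where C = 3 and G = ?G and z = z])
    fix n k l :: nat assume kl: "1 \<le> l" "l \<le> k" "k < n"
    show "expected_reward n 2 k l / n \<le> ?G z + 3 / n"
    proof (cases "l = 1")
      case True
      have "?G (k / n) \<le> ?G z"
        unfolding G using z kl by (intro quadratic_minus_x_ln_x_le) auto
      then show ?thesis using expected_reward_two_bounds(2)[of k n] kl True by simp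
    next
      case False
      then have "expected_reward n 2 k l / n \<le> 1 / 2 + 1 / n"
        using kl by (intro expected_reward_two_le_half) auto
      also have "\<dots> \<le> ?G z + 3 / n"
        unfolding G using half by (intro add_mono divide_right_mono) auto
      finally show ?thesis .
    qed
  next
    fix n k :: nat assume k: "1 \<le> k" "k < n"
    have "1 / real n \<le> 3 / n" by (intro divide_right_mono) auto
    then show "?G (k / n) - 3 / n \<le> expected_reward n 2 k 1 / n"
      using expected_reward_two_bounds(1)[OF k] by simp
  qed (use z in \<open>auto intro!: continuous_intros\<close>)
  then show ?thesis unfolding G .
qed

theorem theorem3:
  "convergent (\<lambda>n. max_reward n 1 / real n) \<and>
   limit_const 1 = 1 / exp 1 \<and>
   \<bar>limit_const 1 - 0.36788\<bar> \<le> 0.000005 \<and>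
   convergent (\<lambda>n. max_reward n 2 / real n) \<and>
   (\<exists>x y :: real. x < y \<and> {z. 0 < z \<and> 2 * z - 2 * ln z = 3} = {x, y} \<and>
      limit_const 2 = 2 * x - x\<^sup>2) \<and>
   \<bar>limit_const 2 - 0.51239\<bar> \<le> 0.000005"
proof -
  obtain x y :: real where x: "0.301706 < x" "x < 0.301712" "2 * x - 2 * ln x = 3"
    and y: "1 < y" and roots: "{z. 0 < z \<and> 2 * z - 2 * ln z = 3} = {x, y}"
    by (rule root_equation_solutions)
  have lim1: "limit_const 1 = 1 / exp 1"
    unfolding limit_const_def by (rule limI[OF max_reward_one_tendsto])
  have tendsto2: "(\<lambda>n. max_reward n 2 / n) \<longlonglongrightarrow> 2 * x - x\<^sup>2"
    using x by (intro max_reward_two_tendsto) auto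
  then have lim2: "limit_const 2 = 2 * x - x\<^sup>2"
    unfolding limit_const_def by (rule limI)
  have "\<bar>limit_const 2 - 0.51239\<bar> \<le> 0.000005"
  proof -
    \<comment> \<open>Completing the square makes the dependence on \<open>x\<close> monotone, so
      the endpoints of the bracket give the bounds.\<close>
    have "(1 - x)\<^sup>2 \<le> 0.698294\<^sup>2" "0.698288\<^sup>2 \<le> (1 - x)\<^sup>2"
      using x by (intro power_mono; simp)+
    moreover have "limit_const 2 = 1 - (1 - x)\<^sup>2"
      unfolding lim2 by (simp add: power2_eq_square algebra_simps)
    ultimately show ?thesis unfolding abs_le_iff by (simp add: power_divide)
  qed
  moreover have "x < y" using x y by simp
  ultimately show ?thesis
    using lim1 lim2 roots exp_minus_one_approx max_reward_one_tendsto tendsto2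
    by (auto simp: convergent_def)
qed

end
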